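(* Let $q$ be a positive integer. Every $((q + 1) \times q^2,\ q(q + 1))$-unordered triple array is resolvable.
   Context: An $(r \times c, v)$-unordered triple array on a set $V$ of $v$ symbols is a collection of $c$-subsets $R_1, \dots, R_r \subseteq V$ (row-sets) and $r$-subsets $C_1, \dots, C_c \subseteq V$ (column-sets) such that, for some integers $e, \lambda_{rc}, \lambda_{rr}, \lambda_{cc}$, each symbol lies in exactly $e$ row-sets and exactly $e$ column-sets, $|R_i \cap C_j| = \lambda_{rc}$ for all $i,j$, $|R_i \cap R_s| = \lambda_{rr}$ for all $i \neq s$, and $|C_j \cap C_t| = \lambda_{cc}$ for all $j \neq t$. Necessarily $e = rc/v$. Such an unordered triple array is called resolvable if $\lambda_{rrc} := \frac{e(e-1)}{r-1}$ and $k := \frac{c}{e}$ are integers and the symbol set can be partitioned into $r$ groups of size $k$ such that every column-set contains exactly one symbol from each group, and all symbols of a group lie in exactly the same row-sets. *)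

theory Defs
  imports Main "HOL-Library.Disjoint_Sets"
begin

text \<open>
  The row-sets are the members \<open>R i\<close> with \<open>i < r\<close> and the column-sets the members \<open>C j\<close> with
  \<open>j < c\<close>; as indexed families, they may a priori contain repetitions.
\<close>

definition uta_with_parameters ::
  "nat \<Rightarrow> nat \<Rightarrow> 'a set \<Rightarrow> (nat \<Rightarrow> 'a set) \<Rightarrow> (nat \<Rightarrow> 'a set) \<Rightarrow> nat \<Rightarrow> nat \<Rightarrow> nat \<Rightarrow> nat \<Rightarrow> bool"
  where
  "uta_with_parameters r c V R C e lrc lrr lcc \<longleftrightarrow>
     finite V \<and>
     (\<forall>i<r. R i \<subseteq> V \<and> card (R i) = c) \<and>
     (\<forall>j<c. C j \<subseteq> V \<and> card (C j) = r) \<and>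
     (\<forall>x\<in>V. card {i. i < r \<and> x \<in> R i} = e \<and> card {j. j < c \<and> x \<in> C j} = e) \<and>
     (\<forall>i<r. \<forall>j<c. card (R i \<inter> C j) = lrc) \<and>
     (\<forall>i<r. \<forall>s<r. i \<noteq> s \<longrightarrow> card (R i \<inter> R s) = lrr) \<and>
     (\<forall>j<c. \<forall>t<c. j \<noteq> t \<longrightarrow> card (C j \<inter> C t) = lcc)"

definition unordered_triple_array ::
  "nat \<Rightarrow> nat \<Rightarrow> nat \<Rightarrow> 'a set \<Rightarrow> (nat \<Rightarrow> 'a set) \<Rightarrow> (nat \<Rightarrow> 'a set) \<Rightarrow> bool" where
  "unordered_triple_array r c v V R C \<longleftrightarrow>
     card V = v \<and> (\<exists>e lrc lrr lcc. uta_with_parameters r c V R C e lrc lrr lcc)"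

text \<open>
  The integrality of \<open>e(e - 1)/(r - 1)\<close> and of \<open>k = c/e\<close> is expressed by divisibility, over the
  integers in the first case to avoid truncated subtraction. The number \<open>e\<close> is determined by
  the array as soon as \<open>V\<close> is nonempty.
\<close>

definition resolvable_unordered_triple_array ::
  "nat \<Rightarrow> nat \<Rightarrow> nat \<Rightarrow> 'a set \<Rightarrow> (nat \<Rightarrow> 'a set) \<Rightarrow> (nat \<Rightarrow> 'a set) \<Rightarrow> bool" where
  "resolvable_unordered_triple_array r c v V R C \<longleftrightarrow>
     card V = v \<and>
     (\<exists>e lrc lrr lcc. uta_with_parameters r c V R C e lrc lrr lcc \<and>
        (int r - 1) dvd int e * (int e - 1) \<and>
        e dvd c \<and>
        (\<exists>P. partition_on V P \<and> card P = r \<and>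
           (\<forall>G\<in>P. card G = c div e) \<and>
           (\<forall>j<c. \<forall>G\<in>P. \<exists>!x. x \<in> C j \<inter> G) \<and>
           (\<forall>G\<in>P. \<forall>x\<in>G. \<forall>y\<in>G. \<forall>i<r. x \<in> R i \<longleftrightarrow> y \<in> R i)))"

end

theory Submission
  imports Defs
begin

text \<open>
  Counting incidences between symbols and row-sets gives \<open>e = q\<close>, so each symbol misses exactly
  one of the \<open>q + 1\<close> row-sets. Hence the complements of the row-sets partition the symbols into
  \<open>q + 1\<close> groups of size \<open>q\<close>. Counting inside a column-set gives \<open>\<lambda>\<^sub>r\<^sub>c = q\<close>, so each
  column-set meets each complement in exactly one symbol.
\<close>

text \<open>Double counting of the pairs \<open>(i, x)\<close> with \<open>x\<close> in both
  \<open>S i\<close> and \<open>T\<close>. The set \<open>T\<close> is left general because it is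
  used once as all of \<open>V\<close> and once as a single column-set.\<close>

lemma sum_card_Int_regular:
  fixes S :: "nat \<Rightarrow> 'a set"
  assumes "finite T" and "\<And>x. x \<in> T \<Longrightarrow> card {i. i < n \<and> x \<in> S i} = e"
  shows "(\<Sum>i<n. card (S i \<inter> T)) = e * card T"
proof -
  have "(\<Sum>i<n. card {x\<in>T. x \<in> S i}) = e * card T"
    using assms by (intro sum_multicount) auto
  moreover have "{x\<in>T. x \<in> S i} = S i \<inter> T" for i by auto
  ultimately show ?thesis by simp
qed

lemma card_1_ex1: "card A = 1 \<Longrightarrow> \<exists>!x. x \<in> A"
  by (auto simp: card_1_singleton_iff)

theorem theorem10:
  fixes q :: nat and V :: "'a set" and R C :: "nat \<Rightarrow> 'a set"
  assumes "q > 0"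
    and "unordered_triple_array (q + 1) (q ^ 2) (q * (q + 1)) V R C"
  shows "resolvable_unordered_triple_array (q + 1) (q ^ 2) (q * (q + 1)) V R C"
proof -
  from assms(2) obtain e lrc lrr lcc where
    cV: "card V = q * (q + 1)"
    and U: "uta_with_parameters (q + 1) (q ^ 2) V R C e lrc lrr lcc"
    unfolding unordered_triple_array_def by blast
  note D = U[unfolded uta_with_parameters_def]
  have fV: "finite V" using D by blast
  have R: "R i \<subseteq> V" "card (R i) = q ^ 2" if "i < q + 1" for i using D that by blast+
  have C: "C j \<subseteq> V" "card (C j) = q + 1" if "j < q ^ 2" for j using D that by blast+
  have e: "card {i. i < q + 1 \<and> x \<in> R i} = e" if "x \<in> V" for x using D that by blast
  have rc: "card (R i \<inter> C j) = lrc" if "i < q + 1" "j < q ^ 2" for i j using D that by blast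

  have "(\<Sum>i<q+1. card (R i \<inter> V)) = e * card V"
    using fV e by (rule sum_card_Int_regular)
  moreover have "(\<Sum>i<q+1. card (R i \<inter> V)) = (\<Sum>i<q+1. q ^ 2)"
    using R by (intro sum.cong) (auto simp: Int_absorb2)
  ultimately have "(q * (q + 1)) * e = (q * (q + 1)) * q"
    by (simp add: cV power2_eq_square algebra_simps)
  then have eq: "e = q" using assms(1) by simp

  \<comment> \<open>Existence of the missed index will make the complements cover \<open>V\<close>;
    uniqueness will make them pairwise disjoint.\<close>
  have missing: "\<exists>!i. i < q + 1 \<and> x \<notin> R i" if "x \<in> V" for x
  proof -
    have "{i. i < q + 1 \<and> x \<notin> R i} = {..<q+1} - {i. i < q + 1 \<and> x \<in> R i}" by auto
    moreover have "card \<dots> = q + 1 - q"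
      using e[OF that] eq by (subst card_Diff_subset) auto
    ultimately have "card {i. i < q + 1 \<and> x \<notin> R i} = 1" by simp
    then show ?thesis using card_1_ex1 by fastforce
  qed

  have column: "\<exists>!x. x \<in> C j \<inter> (V - R i)" if ij: "i < q + 1" "j < q ^ 2" for i j
  proof -
    have fC: "finite (C j)" using C(1)[OF ij(2)] fV by (rule finite_subset)
    have "(\<Sum>i<q+1. card (R i \<inter> C j)) = e * card (C j)"
      using fC e C(1)[OF ij(2)] by (intro sum_card_Int_regular) auto
    \<comment> \<open>All \<open>q + 1\<close> summands equal \<open>lrc\<close>, while the double
      count gives \<open>q * (q + 1)\<close>, so \<open>lrc = q\<close> and
      \<open>(q + 1) - q = 1\<close> symbol of \<open>C j\<close> lies outside
      \<open>R i\<close>.\<close>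
    moreover have "(\<Sum>i<q+1. card (R i \<inter> C j)) = (\<Sum>i<q+1. lrc)"
      using rc ij by (intro sum.cong) auto
    ultimately have "(q + 1) * lrc = (q + 1) * q"
      using C(2)[OF ij(2)] eq by (simp add: algebra_simps)
    then have "lrc = q" by (metis mult_left_cancel add_is_0 one_neq_zero)
    moreover have "C j \<inter> (V - R i) = C j - R i \<inter> C j" using C(1)[OF ij(2)] by auto
    moreover have "card (C j - R i \<inter> C j) = card (C j) - card (R i \<inter> C j)"
      using fC by (intro card_Diff_subset) auto
    ultimately have "card (C j \<inter> (V - R i)) = 1" using rc[OF ij] C(2)[OF ij(2)] by simp
    then show ?thesis by (rule card_1_ex1)
  qed

  define P where "P = (\<lambda>i. V - R i) ` {..<q+1}"
  \<comment> \<open>The size is \<open>q * (q + 1) - q ^ 2\<close>.\<close>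
  have cG: "card (V - R i) = q" if "i < q + 1" for i
    using R[OF that] fV cV
    by (subst card_Diff_subset) (auto intro: finite_subset simp: power2_eq_square)
  have ne: "V - R i \<noteq> {}" if "i < q + 1" for i
    using cG[OF that] assms(1) by (metis card.empty less_numeral_extra(3))
  have disj: "(V - R i) \<inter> (V - R s) = {}" if "i < q + 1" "s < q + 1" "i \<noteq> s" for i s
    using missing that by blast
  \<comment> \<open>Two equal complements with different indices would be disjoint from themselves,
    hence empty, which \<open>q > 0\<close> excludes. So there are exactly \<open>q + 1\<close>
    groups.\<close>
  have "inj_on (\<lambda>i. V - R i) {..<q+1}"
    by (rule inj_onI) (metis disj ne lessThan_iff Int_absorb)
  then have "card P = q + 1" unfolding P_def by (simp add: card_image)
  moreover have "partition_on V P"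
  proof (rule partition_onI)
    show "\<Union>P = V" unfolding P_def using missing by fastforce
    show "{} \<notin> P" unfolding P_def using ne by force
    show "disjnt p p'" if "p \<in> P" "p' \<in> P" "p \<noteq> p'" for p p'
      using that disj unfolding P_def disjnt_def by blast
  qed
  moreover have "\<forall>G\<in>P. card G = q ^ 2 div e"
    using cG assms(1) unfolding P_def eq by (auto simp: power2_eq_square)
  moreover have "\<forall>j<q^2. \<forall>G\<in>P. \<exists>!x. x \<in> C j \<inter> G"
    unfolding P_def using column by simp
  moreover have "\<forall>G\<in>P. \<forall>x\<in>G. \<forall>y\<in>G. \<forall>i<q+1. x \<in> R i \<longleftrightarrow> y \<in> R i"
  proof (intro ballI allI impI)
    fix G x y i
    assume "G \<in> P" "x \<in> G" "y \<in> G" and i: "i < q + 1"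
    then obtain s where s: "s < q + 1" "x \<in> V" "x \<notin> R s" "y \<in> V" "y \<notin> R s"
      unfolding P_def by auto
    \<comment> \<open>A symbol of the group \<open>V - R s\<close> misses \<open>R s\<close> and no
      other row-set, so \<open>s\<close> alone decides its memberships.\<close>
    have "z \<in> R i \<longleftrightarrow> i \<noteq> s" if "z \<in> V" "z \<notin> R s" for z
      using missing[OF that(1)] that(2) s(1) i by metis
    then show "x \<in> R i \<longleftrightarrow> y \<in> R i" using s by simp
  qed
  \<comment> \<open>With \<open>e = q\<close> and \<open>r = q + 1\<close> the two quotients are
    \<open>q - 1\<close> and \<open>q\<close>.\<close>
  moreover have "(int (q + 1) - 1) dvd int e * (int e - 1)" "e dvd q ^ 2"
    by (simp_all add: eq power2_eq_square)
  ultimately show ?thesis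
    unfolding resolvable_unordered_triple_array_def using cV U
    by (intro conjI exI[of _ e] exI[of _ lrc] exI[of _ lrr] exI[of _ lcc] exI[of _ P])
      assumption+
qed

end
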